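(* For all integers $n\ge 0$, $\mathrm{cp}_{0,1,1}(n)$ is the total number of parts (counted with multiplicity) among all partitions of $n$. Equivalently, $\mathrm{cp}_{0,1,1}(n)$ is the sum, over all partitions $\lambda$ of $n$, of the largest part of $\lambda$.
   Context: A partition of a non-negative integer $n$ is a finite multiset of positive integers (its parts) with sum $n$; the empty multiset is the unique partition of $0$ (it has no parts, and its largest part is taken to be $0$). A $(0,1,1)$-copartition is a triple $(\gamma,\rho,\sigma)$ where $\gamma$ is a finite (possibly empty) multiset of non-negative integers (so parts equal to $0$ are allowed in $\gamma$, with multiplicity, and count as parts), $\sigma$ is a nonempty finite multiset of positive integers, and $\rho$ is the multiset having the same number of parts as $\sigma$, each of which has size equal to the number of parts of $\gamma$ (zero parts of $\gamma$ included in the count; if $\gamma$ is empty, $\rho$ is regarded as empty). Its size is $|\gamma|+|\rho|+|\sigma|$, where $|\cdot|$ denotes the sum of parts. $\mathrm{cp}_{0,1,1}(n)$ is the number of $(0,1,1)$-copartitions of size $n$. *)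

theory Defs
  imports Main "HOL-Library.Multiset"
begin

definition partitions :: "nat \<Rightarrow> nat multiset set" where
  "partitions n = {p. (\<forall>i \<in># p. 0 < i) \<and> sum_mset p = n}"

definition largest_part :: "nat multiset \<Rightarrow> nat" where
  "largest_part p = (if p = {#} then 0 else Max_mset p)"

text \<open>
  In a triple \<open>(\<gamma>, \<rho>, \<sigma>)\<close> the number 0 may be a part of \<open>\<gamma>\<close>, but not of \<open>\<sigma>\<close>;
  \<^const>\<open>size\<close> counts parts with multiplicity, so it includes the zero parts of \<open>\<gamma>\<close>.
\<close>

definition copartitions_011 :: "(nat multiset \<times> nat multiset \<times> nat multiset) set" where
  "copartitions_011 = {(\<gamma>, \<rho>, \<sigma>).
     \<sigma> \<noteq> {#} \<and> (\<forall>i \<in># \<sigma>. 0 < i) \<and>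
     \<rho> = (if \<gamma> = {#} then {#} else replicate_mset (size \<sigma>) (size \<gamma>))}"

fun copartition_size :: "nat multiset \<times> nat multiset \<times> nat multiset \<Rightarrow> nat" where
  "copartition_size (\<gamma>, \<rho>, \<sigma>) = sum_mset \<gamma> + sum_mset \<rho> + sum_mset \<sigma>"

definition cp_011 :: "nat \<Rightarrow> nat" where
  "cp_011 n = card {c \<in> copartitions_011. copartition_size c = n}"

text \<open>
  The sets counted and summed over are finite, so \<^const>\<open>card\<close> and \<^const>\<open>sum\<close>
  do not take their default value 0.
\<close>

lemma finite_bounded_multisets:
  "finite {M :: nat multiset. set_mset M \<subseteq> {..n} \<and> size M \<le> n}"
proof -
  have "{M :: nat multiset. set_mset M \<subseteq> {..n} \<and> size M \<le> n}
      \<subseteq> mset ` {xs. set xs \<subseteq> {..n} \<and> length xs \<le> n}"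
  proof
    fix M :: "nat multiset"
    assume M: "M \<in> {M. set_mset M \<subseteq> {..n} \<and> size M \<le> n}"
    obtain xs where "mset xs = M"
      using ex_mset by blast
    with M show "M \<in> mset ` {xs. set xs \<subseteq> {..n} \<and> length xs \<le> n}"
      by auto
  qed
  then show ?thesis
    by (rule finite_subset) (intro finite_imageI finite_lists_length_le finite_atMost)
qed

lemma member_le_sum_mset: "(i :: nat) \<in># M \<Longrightarrow> i \<le> sum_mset M"
  by (auto dest: multi_member_split)

lemma size_le_sum_mset:
  fixes M :: "nat multiset"
  assumes "\<forall>i \<in># M. 0 < i"
  shows "size M \<le> sum_mset M"
  using assms by (induction M) auto

lemma finite_partitions: "finite (partitions n)"
  by (rule finite_subset[OF _ finite_bounded_multisets[of n]])
    (auto simp: partitions_def dest: member_le_sum_mset size_le_sum_mset)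

lemma finite_copartitions_011: "finite {c \<in> copartitions_011. copartition_size c = n}"
proof -
  let ?B = "{M :: nat multiset. set_mset M \<subseteq> {..n} \<and> size M \<le> n}"
  let ?r = "\<lambda>(\<gamma>, \<sigma>). (\<gamma>, if \<gamma> = {#} then {#} else replicate_mset (size \<sigma>) (size \<gamma>), \<sigma>)"
  have "{c \<in> copartitions_011. copartition_size c = n} \<subseteq> ?r ` (?B \<times> ?B)"
  proof
    fix c
    assume c: "c \<in> {c \<in> copartitions_011. copartition_size c = n}"
    obtain \<gamma> \<rho> \<sigma> where ceq: "c = (\<gamma>, \<rho>, \<sigma>)"
      by (cases c)
    have \<sigma>: "\<sigma> \<noteq> {#}" "\<forall>i \<in># \<sigma>. 0 < i"
      and \<rho>: "\<rho> = (if \<gamma> = {#} then {#} else replicate_mset (size \<sigma>) (size \<gamma>))"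
      and n: "sum_mset \<gamma> + sum_mset \<rho> + sum_mset \<sigma> = n"
      using c by (auto simp: ceq copartitions_011_def)
    have "size \<sigma> \<ge> 1"
      using \<sigma>(1) by (simp add: Suc_le_eq nonempty_has_size)
    then have "size \<gamma> \<le> size \<sigma> * size \<gamma>"
      by simp
    also have "\<dots> = sum_mset \<rho>"
      using \<rho> by simp
    finally have "\<gamma> \<in> ?B"
      using n by (auto dest: member_le_sum_mset)
    moreover have "\<sigma> \<in> ?B"
      using n size_le_sum_mset[OF \<sigma>(2)] by (auto dest: member_le_sum_mset)
    ultimately show "c \<in> ?r ` (?B \<times> ?B)"
      by (intro image_eqI[of _ _ "(\<gamma>, \<sigma>)"]) (auto simp: ceq \<rho>)
  qed
  then show ?thesis
    by (rule finite_subset) (intro finite_imageI finite_cartesian_product finite_bounded_multisets)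
qed

end

theory Submission
  imports Defs
begin

text \<open>
  Fix \<open>k\<close> and a partition \<open>\<lambda>\<close> of \<open>n\<close> whose largest part exceeds \<open>k\<close>. Subtracting \<open>k\<close> from each
  part greater than \<open>k\<close> gives a nonempty multiset \<open>\<sigma>\<close> of positive integers, and the parts that are
  at most \<open>k\<close> form a partition \<open>\<mu>\<close>, where \<open>|\<mu>| + |\<sigma>| + k * size \<sigma> = n\<close>. The copartitions of size
  \<open>n\<close> with \<open>size \<gamma> = k\<close> consist of the same kind of \<open>\<sigma>\<close> together with a multiset \<open>\<gamma>\<close> of \<open>k\<close>
  non-negative integers, subject to \<open>|\<gamma>| + |\<sigma>| + k * size \<sigma> = n\<close>. There are as many \<open>\<mu>\<close> as \<open>\<gamma>\<close>
  of any given sum: classically by conjugation of Young diagrams, and here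
  (\<open>card_partitions_le_eq_card_multisets_of_size\<close>) because both numbers satisfy the same
  recurrence. Hence copartitions of size \<open>n\<close> are equinumerous with pairs \<open>(\<lambda>, k)\<close>,
  \<open>k < largest_part \<lambda>\<close>.

  The same count says that as many partitions of \<open>n\<close> have at most \<open>k\<close> parts as have all parts at
  most \<open>k\<close>, since padding with zeros turns the former into multisets of size \<open>k\<close>. Number of parts
  and largest part are therefore equidistributed over the partitions of \<open>n\<close>, so that their
  sums agree.
\<close>

section \<open>Partitions with bounded parts and multisets of fixed size\<close>

text \<open>The partitions of \<open>s\<close> with all parts at most \<open>k\<close>.\<close>

definition partitions_le :: "nat \<Rightarrow> nat \<Rightarrow> nat multiset set" where
  "partitions_le k s = {\<mu> \<in> partitions s. \<forall>i \<in># \<mu>. i \<le> k}"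

text \<open>
  The multisets of \<open>k\<close> non-negative integers with sum \<open>s\<close>. The number 0 may be an element of
  these multisets, as in the first component of a copartition.
\<close>

definition multisets_of_size :: "nat \<Rightarrow> nat \<Rightarrow> nat multiset set" where
  "multisets_of_size k s = {\<gamma>. size \<gamma> = k \<and> sum_mset \<gamma> = s}"

lemma finite_partitions_le: "finite (partitions_le k s)"
  unfolding partitions_le_def by (simp add: finite_partitions)

lemma finite_multisets_of_size: "finite (multisets_of_size k s)"
  by (rule finite_subset[OF _ finite_bounded_multisets[of "k + s"]])
    (auto simp: multisets_of_size_def dest: member_le_sum_mset)

lemma sum_mset_image_Suc: "sum_mset (image_mset Suc M) = sum_mset M + size M"
  by (induction M) auto

lemma sum_mset_image_add:
  fixes M :: "nat multiset"
  shows "sum_mset (image_mset (\<lambda>x. x + k) M) = sum_mset M + k * size M"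
  by (induction M) auto

lemma partitions_le_0: "partitions_le 0 s = (if s = 0 then {{#}} else {})"
proof -
  have "\<mu> = {#} \<and> s = 0" if "\<mu> \<in> partitions_le 0 s" for \<mu>
    using that by (cases \<mu>) (auto simp: partitions_le_def partitions_def)
  moreover have "{#} \<in> partitions_le 0 0"
    by (simp add: partitions_le_def partitions_def)
  ultimately show ?thesis
    by auto
qed

lemma multisets_of_size_0: "multisets_of_size 0 s = (if s = 0 then {{#}} else {})"
  by (auto simp: multisets_of_size_def)

text \<open>Split according to whether the largest admissible part \<open>Suc k\<close> occurs.\<close>

lemma partitions_le_Suc:
  "partitions_le (Suc k) s = partitions_le k s \<union>
     (if Suc k \<le> s then add_mset (Suc k) ` partitions_le (Suc k) (s - Suc k) else {})"
  (is "?L = ?A \<union> ?B")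
proof
  show "?L \<subseteq> ?A \<union> ?B"
  proof
    fix \<mu> assume \<mu>: "\<mu> \<in> ?L"
    show "\<mu> \<in> ?A \<union> ?B"
    proof (cases "Suc k \<in># \<mu>")
      case True
      then obtain \<nu> where \<nu>: "\<mu> = add_mset (Suc k) \<nu>"
        by (blast dest: multi_member_split)
      with \<mu> have "\<nu> \<in> partitions_le (Suc k) (s - Suc k)" "Suc k \<le> s"
        by (auto simp: partitions_le_def partitions_def)
      with \<nu> show ?thesis by auto
    next
      case False
      then have "\<forall>i \<in># \<mu>. i \<le> k"
        using \<mu> by (auto simp: partitions_le_def le_Suc_eq)
      with \<mu> show ?thesis by (auto simp: partitions_le_def)
    qed
  qed
  show "?A \<union> ?B \<subseteq> ?L"
    by (auto simp: partitions_le_def partitions_def le_Suc_eq)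
qed

text \<open>Split according to whether 0 is an element; if not, all elements can be lowered by 1.\<close>

lemma multisets_of_size_Suc:
  "multisets_of_size (Suc k) s = add_mset 0 ` multisets_of_size k s \<union>
     (if Suc k \<le> s then image_mset Suc ` multisets_of_size (Suc k) (s - Suc k) else {})"
  (is "?L = ?A \<union> ?B")
proof
  show "?L \<subseteq> ?A \<union> ?B"
  proof
    fix \<gamma> assume \<gamma>: "\<gamma> \<in> ?L"
    show "\<gamma> \<in> ?A \<union> ?B"
    proof (cases "0 \<in># \<gamma>")
      case True
      then obtain \<delta> where \<delta>: "\<gamma> = add_mset 0 \<delta>"
        by (blast dest: multi_member_split)
      with \<gamma> have "\<delta> \<in> multisets_of_size k s"
        by (auto simp: multisets_of_size_def)
      with \<delta> show ?thesis by auto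
    next
      case False
      define \<delta> where "\<delta> = image_mset (\<lambda>x. x - 1) \<gamma>"
      have "image_mset Suc \<delta> = image_mset (\<lambda>x. x) \<gamma>"
        unfolding \<delta>_def multiset.map_comp
        by (rule image_mset_cong) (use False in \<open>metis One_nat_def Suc_pred comp_apply neq0_conv\<close>)
      then have \<delta>: "\<gamma> = image_mset Suc \<delta>" by simp
      have "size \<delta> = Suc k" "sum_mset \<delta> + Suc k = s"
        using \<gamma> unfolding \<delta> multisets_of_size_def by (auto simp: sum_mset_image_Suc)
      then have "\<delta> \<in> multisets_of_size (Suc k) (s - Suc k)" "Suc k \<le> s"
        by (auto simp: multisets_of_size_def)
      with \<delta> show ?thesis by auto
    qed
  qed
  show "?A \<union> ?B \<subseteq> ?L"
    by (auto simp: multisets_of_size_def sum_mset_image_Suc)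
qed

lemma card_partitions_le_Suc:
  "card (partitions_le (Suc k) s) = card (partitions_le k s) +
     (if Suc k \<le> s then card (partitions_le (Suc k) (s - Suc k)) else 0)"
proof -
  have "card (add_mset (Suc k) ` partitions_le (Suc k) t) = card (partitions_le (Suc k) t)" for t
    by (rule card_image) (auto simp: inj_on_def)
  moreover have "partitions_le k s \<inter> add_mset (Suc k) ` partitions_le (Suc k) t = {}" for t
    by (auto simp: partitions_le_def)
  ultimately show ?thesis
    by (subst partitions_le_Suc) (auto simp: card_Un_disjoint finite_partitions_le)
qed

lemma card_multisets_of_size_Suc:
  "card (multisets_of_size (Suc k) s) = card (multisets_of_size k s) +
     (if Suc k \<le> s then card (multisets_of_size (Suc k) (s - Suc k)) else 0)"
proof -
  have "card (add_mset 0 ` multisets_of_size k s) = card (multisets_of_size k s)"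
    by (rule card_image) (auto simp: inj_on_def)
  moreover have "card (image_mset Suc ` multisets_of_size (Suc k) t)
      = card (multisets_of_size (Suc k) t)" for t
    by (rule card_image) (meson multiset.inj_map inj_Suc inj_on_subset subset_UNIV)
  moreover have "add_mset 0 ` multisets_of_size k s
      \<inter> image_mset Suc ` multisets_of_size (Suc k) t = {}" for t
  proof -
    have "add_mset 0 M \<noteq> image_mset Suc N" for M N
    proof
      assume "add_mset 0 M = image_mset Suc N"
      then have "0 \<in># image_mset Suc N" by (metis union_single_eq_member)
      then show False by auto
    qed
    then show ?thesis by blast
  qed
  ultimately show ?thesis
    by (subst multisets_of_size_Suc) (auto simp: card_Un_disjoint finite_multisets_of_size)
qed

lemma card_partitions_le_eq_card_multisets_of_size:
  "card (partitions_le k s) = card (multisets_of_size k s)"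
proof (induction "k + s" arbitrary: k s rule: less_induct)
  case less
  show ?case
  proof (cases k)
    case 0
    then show ?thesis by (simp add: partitions_le_0 multisets_of_size_0)
  next
    case (Suc j)
    then show ?thesis
      using less[of j s] less[of "Suc j" "s - Suc j"]
      by (simp add: card_partitions_le_Suc card_multisets_of_size_Suc)
  qed
qed

section \<open>Number of parts and largest part\<close>

lemma largest_part_le_iff: "largest_part p \<le> k \<longleftrightarrow> (\<forall>i \<in># p. i \<le> k)"
  by (auto simp: largest_part_def)

lemma card_partitions_size_le:
  "card {p \<in> partitions n. size p \<le> k} = card (multisets_of_size k n)"
proof -
  have drop_0: "sum_mset (filter_mset ((<) 0) M) = sum_mset M"
    "filter_mset ((<) 0) M + replicate_mset (size M - size (filter_mset ((<) 0) M)) 0 = M"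
    for M :: "nat multiset"
  proof (induction M)
    case (add x M)
    {
      case 1
      show ?case using add by auto
    next
      case 2
      show ?case using add size_filter_mset_lesseq[of "(<) 0" M] by (auto simp: Suc_diff_le)
    }
  qed auto
  have no_0: "filter_mset ((<) 0) p = p" if "p \<in> partitions n" for p
    using that by (auto simp: partitions_def filter_mset_eq_conv)
  \<comment> \<open>pad with zeros up to size \<open>k\<close>; conversely drop all zeros\<close>
  have "bij_betw (\<lambda>p. p + replicate_mset (k - size p) 0)
          {p \<in> partitions n. size p \<le> k} (multisets_of_size k n)"
  proof (rule bij_betw_byWitness[where f' = "filter_mset ((<) 0)"])
    show "\<forall>p \<in> {p \<in> partitions n. size p \<le> k}.
        filter_mset ((<) 0) (p + replicate_mset (k - size p) 0) = p"
      by (auto simp: no_0 filter_mset_eq_conv)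
    show "\<forall>\<gamma> \<in> multisets_of_size k n. filter_mset ((<) 0) \<gamma>
        + replicate_mset (k - size (filter_mset ((<) 0) \<gamma>)) 0 = \<gamma>"
      using drop_0(2) by (auto simp: multisets_of_size_def)
    show "(\<lambda>p. p + replicate_mset (k - size p) 0) ` {p \<in> partitions n. size p \<le> k}
        \<subseteq> multisets_of_size k n"
      by (auto simp: multisets_of_size_def partitions_def)
    show "filter_mset ((<) 0) ` multisets_of_size k n \<subseteq> {p \<in> partitions n. size p \<le> k}"
      by (auto simp: multisets_of_size_def partitions_def drop_0(1) size_filter_mset_lesseq)
  qed
  then show ?thesis by (rule bij_betw_same_card)
qed

lemma sum_eq_if_equidistributed:
  fixes f g :: "'a \<Rightarrow> nat"
  assumes fin: "finite A"
    and eq: "\<And>k. card {x \<in> A. f x \<le> k} = card {x \<in> A. g x \<le> k}"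
  shows "sum f A = sum g A"
proof -
  \<comment> \<open>any common upper bound of \<open>f\<close> and \<open>g\<close> on \<open>A\<close> would do; \<open>h x\<close> is the number of \<open>k < N\<close>
    with \<open>k < h x\<close>\<close>
  define N where "N = sum f A + sum g A"
  have layers: "sum h A = (\<Sum>k<N. card A - card {x \<in> A. h x \<le> k})"
    if "\<And>x. x \<in> A \<Longrightarrow> h x \<le> N" for h :: "'a \<Rightarrow> nat"
  proof -
    have "sum h A = (\<Sum>x\<in>A. card {k \<in> {..<N}. k < h x})"
    proof (rule sum.cong[OF refl])
      fix x assume "x \<in> A"
      then have "{k \<in> {..<N}. k < h x} = {..<h x}" using that[of x] by auto
      then show "h x = card {k \<in> {..<N}. k < h x}" by simp
    qed
    also have "\<dots> = (\<Sum>k<N. card {x \<in> A. k < h x})"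
      using sum_multicount_gen[OF fin finite_lessThan[of N], of "\<lambda>x k. k < h x"] by simp
    also have "\<dots> = (\<Sum>k<N. card A - card {x \<in> A. h x \<le> k})"
    proof (rule sum.cong[OF refl])
      fix k
      have "{x \<in> A. k < h x} = A - {x \<in> A. h x \<le> k}" by auto
      then show "card {x \<in> A. k < h x} = card A - card {x \<in> A. h x \<le> k}"
        using fin by (simp add: card_Diff_subset)
    qed
    finally show ?thesis .
  qed
  have "f x \<le> N" "g x \<le> N" if "x \<in> A" for x
    using member_le_sum[of x A f] member_le_sum[of x A g] fin that by (auto simp: N_def)
  then show ?thesis
    by (simp add: layers eq)
qed

lemma sum_size_eq_sum_largest_part:
  "(\<Sum>p\<in>partitions n. size p) = (\<Sum>p\<in>partitions n. largest_part p)"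
proof (rule sum_eq_if_equidistributed[OF finite_partitions])
  fix k
  have "{p \<in> partitions n. largest_part p \<le> k} = partitions_le k n"
    by (auto simp: partitions_le_def largest_part_le_iff)
  then show "card {p \<in> partitions n. size p \<le> k} = card {p \<in> partitions n. largest_part p \<le> k}"
    by (simp add: card_partitions_size_le card_partitions_le_eq_card_multisets_of_size)
qed

section \<open>Copartitions and the largest part\<close>

text \<open>
  In a pair \<open>(k, \<sigma>)\<close>, the multiset \<open>\<sigma>\<close> is the third component of a copartition and \<open>k\<close> is the size
  of its first component; \<open>weight\<close> is the contribution of the second and third components to the
  copartition size. If \<open>k = 0\<close>, the second component is empty and contributes \<open>0 = k * size \<sigma>\<close>.
\<close>

definition weight :: "nat \<times> nat multiset \<Rightarrow> nat" where
  "weight = (\<lambda>(k, \<sigma>). sum_mset \<sigma> + k * size \<sigma>)"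

text \<open>The pairs whose weight does not exceed the size \<open>n\<close> of the copartition.\<close>

definition admissible :: "nat \<Rightarrow> (nat \<times> nat multiset) set" where
  "admissible n = {(k, \<sigma>). \<sigma> \<noteq> {#} \<and> (\<forall>i \<in># \<sigma>. 0 < i) \<and> weight (k, \<sigma>) \<le> n}"

lemma finite_admissible: "finite (admissible n)"
proof -
  have "admissible n \<subseteq> {..n} \<times> {M. set_mset M \<subseteq> {..n} \<and> size M \<le> n}"
  proof (clarsimp simp: admissible_def weight_def, intro conjI)
    fix k and \<sigma> :: "nat multiset"
    assume \<sigma>: "\<sigma> \<noteq> {#}" "\<forall>i \<in># \<sigma>. 0 < i" and le: "sum_mset \<sigma> + k * size \<sigma> \<le> n"
    have "1 \<le> size \<sigma>"
      using \<sigma>(1) by (simp add: Suc_le_eq nonempty_has_size)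
    then have "k \<le> k * size \<sigma>" by simp
    with le show "k \<le> n" by linarith
    show "set_mset \<sigma> \<subseteq> {..n}"
      using le by (auto dest: member_le_sum_mset)
    show "size \<sigma> \<le> n"
      using le size_le_sum_mset[OF \<sigma>(2)] by linarith
  qed
  then show ?thesis
    by (rule finite_subset) (intro finite_cartesian_product finite_bounded_multisets finite_atMost)
qed

lemma cp_011_eq_sum:
  "cp_011 n = (\<Sum>x\<in>admissible n. card (multisets_of_size (fst x) (n - weight x)))"
proof -
  have "bij_betw (\<lambda>(\<gamma>, \<rho>, \<sigma>). ((size \<gamma>, \<sigma>), \<gamma>))
      {c \<in> copartitions_011. copartition_size c = n}
      (SIGMA x:admissible n. multisets_of_size (fst x) (n - weight x))"
    by (rule bij_betw_byWitness[where f' = "\<lambda>((k, \<sigma>), \<gamma>).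
          (\<gamma>, if \<gamma> = {#} then {#} else replicate_mset (size \<sigma>) (size \<gamma>), \<sigma>)"])
      (auto simp: copartitions_011_def admissible_def weight_def multisets_of_size_def
        split: if_splits)
  then show ?thesis
    unfolding cp_011_def
    by (simp add: bij_betw_same_card card_SigmaI finite_admissible finite_multisets_of_size)
qed

text \<open>
  The partition \<open>\<lambda>\<close> with mark \<open>k < largest_part \<lambda>\<close> is cut into its parts that are at most \<open>k\<close> and
  its parts that are greater than \<open>k\<close>, the latter lowered by \<open>k\<close>.
\<close>

lemma sum_largest_part_eq_sum:
  "(\<Sum>p\<in>partitions n. largest_part p)
     = (\<Sum>x\<in>admissible n. card (partitions_le (fst x) (n - weight x)))"
proof -
  let ?low = "\<lambda>k. filter_mset (\<lambda>i. i \<le> k)"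
  let ?high = "\<lambda>k p. image_mset (\<lambda>i. i - k) (filter_mset (\<lambda>i. \<not> i \<le> k) p)"
  let ?S = "SIGMA p:partitions n. {..<largest_part p}"
  let ?T = "SIGMA x:admissible n. partitions_le (fst x) (n - weight x)"
  let ?f = "\<lambda>(p, k). ((k, ?high k p), ?low k p)"
  let ?g = "\<lambda>((k, \<sigma>), \<mu>). (\<mu> + image_mset (\<lambda>i. i + k) \<sigma>, k)"
  have glue: "?low k p + image_mset (\<lambda>i. i + k) (?high k p) = p" for k :: nat and p
  proof -
    have "image_mset (\<lambda>i. i + k) (?high k p) = image_mset (\<lambda>i. i) (filter_mset (\<lambda>i. \<not> i \<le> k) p)"
      unfolding multiset.map_comp by (rule image_mset_cong) (simp add: not_le)
    then show ?thesis using multiset_partition[of p "\<lambda>i. i \<le> k"] by simp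
  qed
  have total: "sum_mset (?low k p) + weight (k, ?high k p) = sum_mset p" for k p
    by (subst (3) glue[of k p, symmetric], unfold sum_mset.union sum_mset_image_add)
      (simp add: weight_def)
  have cut: "?low k (\<mu> + image_mset (\<lambda>i. i + k) \<sigma>) = \<mu>"
    "?high k (\<mu> + image_mset (\<lambda>i. i + k) \<sigma>) = \<sigma>"
    if "\<forall>i \<in># \<mu>. i \<le> k" "\<forall>i \<in># \<sigma>. 0 < i" for k :: nat and \<mu> \<sigma>
  proof -
    have "?low k \<mu> = \<mu>" "filter_mset (\<lambda>i. \<not> i \<le> k) \<mu> = {#}"
      using that(1) by (auto simp: filter_mset_eq_conv)
    moreover have "?low k (image_mset (\<lambda>i. i + k) \<sigma>) = {#}"
      "filter_mset (\<lambda>i. \<not> i \<le> k) (image_mset (\<lambda>i. i + k) \<sigma>) = image_mset (\<lambda>i. i + k) \<sigma>"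
      using that(2) by (auto simp: filter_mset_eq_conv)
    ultimately show "?low k (\<mu> + image_mset (\<lambda>i. i + k) \<sigma>) = \<mu>"
      "?high k (\<mu> + image_mset (\<lambda>i. i + k) \<sigma>) = \<sigma>"
      by (simp_all add: multiset.map_comp comp_def)
  qed
  have "bij_betw ?f ?S ?T"
  proof (rule bij_betw_byWitness[where f' = ?g])
    show "\<forall>a\<in>?S. ?g (?f a) = a"
      using glue by auto
    show "\<forall>b\<in>?T. ?f (?g b) = b"
    proof (clarify, goal_cases)
      case (1 k \<sigma> \<mu>)
      then have "\<forall>i \<in># \<mu>. i \<le> k" "\<forall>i \<in># \<sigma>. 0 < i"
        by (auto simp: admissible_def partitions_le_def)
      from cut[OF this] show ?case by (simp only: prod.case)
    qed
    show "?f ` ?S \<subseteq> ?T"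
    proof (clarify, goal_cases)
      case (1 _ _ _ p k)
      then have p: "\<forall>i \<in># p. 0 < i" "sum_mset p = n" and k: "\<not> largest_part p \<le> k"
        by (auto simp: partitions_def)
      have "weight (k, ?high k p) \<le> n" "sum_mset (?low k p) = n - weight (k, ?high k p)"
        using total[of k p] p(2) by linarith+
      moreover have "?high k p \<noteq> {#}"
        using k by (auto simp: largest_part_le_iff filter_mset_eq_conv)
      ultimately show ?case
        using p(1) by (auto simp: admissible_def partitions_le_def partitions_def)
    qed
    show "?g ` ?T \<subseteq> ?S"
    proof (clarify, goal_cases)
      case (1 _ _ k \<sigma> \<mu>)
      let ?p = "\<mu> + image_mset (\<lambda>i. i + k) \<sigma>"
      have \<sigma>: "\<sigma> \<noteq> {#}" "\<forall>i \<in># \<sigma>. 0 < i" and "weight (k, \<sigma>) \<le> n"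
        and \<mu>: "\<forall>i \<in># \<mu>. 0 < i" and "sum_mset \<mu> = n - weight (k, \<sigma>)"
        using 1 by (auto simp: admissible_def partitions_le_def partitions_def)
      then have "sum_mset ?p = n"
        by (simp add: sum_mset_image_add weight_def)
      with \<sigma> \<mu> have "?p \<in> partitions n"
        by (auto simp: partitions_def)
      moreover obtain i where "i \<in># \<sigma>"
        using \<sigma>(1) by blast
      with \<sigma>(2) have "i + k \<in># ?p" "\<not> i + k \<le> k" by auto
      then have "\<not> largest_part ?p \<le> k"
        unfolding largest_part_le_iff by blast
      ultimately show ?case by auto
    qed
  qed
  then have "card ?S = card ?T" by (rule bij_betw_same_card)
  then show ?thesis
    by (simp add: card_SigmaI finite_partitions finite_admissible finite_partitions_le)
qed

theorem theorem4p12: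
  fixes n :: nat
  shows "cp_011 n = (\<Sum>p\<in>partitions n. size p)
    \<and> cp_011 n = (\<Sum>p\<in>partitions n. largest_part p)"
  by (simp add: sum_size_eq_sum_largest_part cp_011_eq_sum sum_largest_part_eq_sum
      card_partitions_le_eq_card_multisets_of_size)

end
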